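(* Let $P$ be a finite poset and let $A$ be a nonempty anti-chain of $P$. Then \[ f_P(\mathbf x)=\sum_{\emptyset\ne M\subseteq A}(-1)^{|M|-1}\, f_{P(M,A)}(\mathbf x)\Big|_{x_M=\prod_{a\in M}x_a}, \] where in the term for $M$ the variable $x_M$ attached to the element $M$ of $P(M,A)$ is replaced by $\prod_{a\in M}x_a$, and the variables of the elements of $P\setminus M$ are the $x_u$ as in $P$.
   Context: For a finite poset $P$, a $P$-partition is a map $\sigma:P\to\mathbb{Z}_{\ge 0}$ with $x\le_P y\Rightarrow\sigma(x)\ge\sigma(y)$; $f_P(\mathbf x)=\sum_{\sigma}\prod_{a\in P}x_a^{\sigma(a)}$, summed over all $P$-partitions, with one variable $x_a$ per element $a$. Partially linear extension: given an anti-chain $A$ of $P$ and a nonempty $M\subseteq A$, $P(M,A)$ is the poset on the set $(P\setminus M)\cup\{M\}$ (the elements of $M$ glued into a single new element, also denoted $M$) in which $x\le y$ iff one of: (a) $x,y\in P\setminus M$ and $x\le_P y$; (b) $x,y\in P\setminus M$ and there exist $x'\in A$, $y'\in M$ with $x\le_P x'$ and $y'\le_P y$; (c) $x=M$ and there exists $y'\in M$ with $y'\le_P y$; (d) $y=M$ and there exists $x'\in A$ with $x\le_P x'$; (e) $x=y=M$. *)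

theory Defs
  imports "HOL-Analysis.Analysis" "HOL-Library.Poly_Mapping"
begin

section \<open>Multivariate formal power series with integer coefficients\<close>

text \<open>
  A monomial in variables indexed by \<open>'v\<close> is an exponent vector \<open>'v \<Rightarrow>\<^sub>0 nat\<close>;
  a power series assigns an integer coefficient to every monomial.
\<close>

typedef 'v mfps = "UNIV :: (('v \<Rightarrow>\<^sub>0 nat) \<Rightarrow> int) set"
  morphisms mcoeff Abs_mfps ..

lemma mcoeff_Abs [simp]: "mcoeff (Abs_mfps f) = f"
  by (simp add: Abs_mfps_inverse)

lemma mfps_eqI: "(\<And>m. mcoeff f m = mcoeff g m) \<Longrightarrow> f = g"
  by (simp add: mcoeff_inject[symmetric] fun_eq_iff)

lemma lookup_le_add:
  fixes p q :: "'v \<Rightarrow>\<^sub>0 nat"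
  shows "Poly_Mapping.lookup p v \<le> Poly_Mapping.lookup (p + q) v"
  by (simp add: lookup_add)

lemma finite_poly_mapping_le:
  fixes m :: "'v \<Rightarrow>\<^sub>0 nat"
  shows "finite {p. \<forall>v. Poly_Mapping.lookup p v \<le> Poly_Mapping.lookup m v}"
proof -
  let ?B = "{f. \<forall>v. (v \<in> Poly_Mapping.keys m \<longrightarrow> f v \<in> {..Max (Poly_Mapping.lookup m ` Poly_Mapping.keys m)}) \<and> (v \<notin> Poly_Mapping.keys m \<longrightarrow> f v = (0::nat))}"
  have "finite ?B"
    by (rule finite_set_of_finite_funs) auto
  moreover have "Poly_Mapping.lookup ` {p. \<forall>v. Poly_Mapping.lookup p v \<le> Poly_Mapping.lookup m v} \<subseteq> ?B"
  proof clarify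
    fix p :: "'v \<Rightarrow>\<^sub>0 nat" and v
    assume le: "\<forall>v. Poly_Mapping.lookup p v \<le> Poly_Mapping.lookup m v"
    have "Poly_Mapping.lookup p v \<le> Max (Poly_Mapping.lookup m ` Poly_Mapping.keys m)" if "v \<in> Poly_Mapping.keys m"
    proof -
      have "Poly_Mapping.lookup m v \<le> Max (Poly_Mapping.lookup m ` Poly_Mapping.keys m)" using that by (intro Max_ge) auto
      then show ?thesis using le order_trans by blast
    qed
    moreover have "Poly_Mapping.lookup p v = 0" if "v \<notin> Poly_Mapping.keys m"
      using le[rule_format, of v] that by (simp add: in_keys_iff)
    ultimately show "(v \<in> Poly_Mapping.keys m \<longrightarrow> Poly_Mapping.lookup p v \<in> {..Max (Poly_Mapping.lookup m ` Poly_Mapping.keys m)}) \<and> (v \<notin> Poly_Mapping.keys m \<longrightarrow> Poly_Mapping.lookup p v = 0)"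
      by auto
  qed
  ultimately have "finite (Poly_Mapping.lookup ` {p. \<forall>v. Poly_Mapping.lookup p v \<le> Poly_Mapping.lookup m v})"
    by (rule finite_subset[rotated])
  then show ?thesis
    by (rule finite_imageD) (auto intro: inj_onI poly_mapping_eqI)
qed

lemma finite_splits [simp]:
  fixes m :: "'v \<Rightarrow>\<^sub>0 nat"
  shows "finite {(p, q). p + q = m}"
proof (rule finite_subset)
  let ?L = "{p. \<forall>v. Poly_Mapping.lookup p v \<le> Poly_Mapping.lookup m v}"
  show "{(p, q). p + q = m} \<subseteq> ?L \<times> ?L"
    by (auto simp: lookup_add)
  show "finite (?L \<times> ?L)"
    using finite_poly_mapping_le by blast
qed

instantiation mfps :: (type) comm_ring_1
begin

definition "0 = Abs_mfps (\<lambda>m. 0)"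
definition "1 = Abs_mfps (\<lambda>m. if m = 0 then 1 else 0)"
definition "f + g = Abs_mfps (\<lambda>m. mcoeff f m + mcoeff g m)"
definition "f - g = Abs_mfps (\<lambda>m. mcoeff f m - mcoeff g m)"
definition "- f = Abs_mfps (\<lambda>m. - mcoeff f m)"
definition "f * g = Abs_mfps (\<lambda>m. \<Sum>(p, q) | p + q = m. mcoeff f p * mcoeff g q)"

lemma mcoeff_0 [simp]: "mcoeff 0 m = 0"
  and mcoeff_1: "mcoeff 1 m = (if m = 0 then 1 else 0)"
  and mcoeff_add [simp]: "mcoeff (f + g) m = mcoeff f m + mcoeff g m"
  and mcoeff_diff [simp]: "mcoeff (f - g) m = mcoeff f m - mcoeff g m"
  and mcoeff_uminus [simp]: "mcoeff (- f) m = - mcoeff f m"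
  and mcoeff_mult: "mcoeff (f * g) m = (\<Sum>(p, q) | p + q = m. mcoeff f p * mcoeff g q)"
  for f g :: "'a mfps"
  by (simp_all add: zero_mfps_def one_mfps_def plus_mfps_def minus_mfps_def uminus_mfps_def times_mfps_def)

instance
proof
  fix f g h :: "'a mfps"
  show "f * g * h = f * (g * h)"
  proof (rule mfps_eqI)
    fix m
    have "mcoeff (f * g * h) m =
      (\<Sum>x\<in>{(p, q). p + q = m}. \<Sum>y\<in>{(a, b). a + b = fst x}.
         mcoeff f (fst y) * mcoeff g (snd y) * mcoeff h (snd x))"
      by (simp add: mcoeff_mult sum_distrib_right case_prod_unfold)
    also have "\<dots> = (\<Sum>(x, y)\<in>(SIGMA x:{(p, q). p + q = m}. {(a, b). a + b = fst x}).
         mcoeff f (fst y) * mcoeff g (snd y) * mcoeff h (snd x))"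
      by (intro sum.Sigma) auto
    also have "\<dots> = (\<Sum>(x, y)\<in>(SIGMA x:{(p, q). p + q = m}. {(a, b). a + b = snd x}).
         mcoeff f (fst x) * (mcoeff g (fst y) * mcoeff h (snd y)))"
      by (rule sum.reindex_bij_witness[where
            i = "\<lambda>((a, q), (b, c)). ((a + b, c), (a, b))" and
            j = "\<lambda>((q, c), (a, b)). ((a, b + c), (b, c))"])
         (auto simp: algebra_simps)
    also have "\<dots> = (\<Sum>x\<in>{(p, q). p + q = m}. \<Sum>y\<in>{(a, b). a + b = snd x}.
         mcoeff f (fst x) * (mcoeff g (fst y) * mcoeff h (snd y)))"
      by (intro sum.Sigma[symmetric]) auto
    also have "\<dots> = mcoeff (f * (g * h)) m"
      by (simp add: mcoeff_mult sum_distrib_left case_prod_unfold)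
    finally show "mcoeff (f * g * h) m = mcoeff (f * (g * h)) m" .
  qed
  show "f * g = g * f"
  proof (rule mfps_eqI)
    fix m
    show "mcoeff (f * g) m = mcoeff (g * f) m"
      unfolding mcoeff_mult
      by (rule sum.reindex_bij_witness[where i = prod.swap and j = prod.swap])
         (auto simp: add.commute mult.commute)
  qed
  show "1 * f = f"
  proof (rule mfps_eqI)
    fix m
    have "mcoeff (1 * f) m = (\<Sum>x\<in>{(p, q). p + q = m}. if x = (0, m) then mcoeff f m else 0)"
      unfolding mcoeff_mult by (intro sum.cong) (auto simp: mcoeff_1 split: if_splits)
    also have "\<dots> = mcoeff f m" by (subst sum.delta) auto
    finally show "mcoeff (1 * f) m = mcoeff f m" .
  qed
  show "(f + g) * h = f * h + g * h"
    by (rule mfps_eqI) (simp add: mcoeff_mult case_prod_unfold algebra_simps sum.distrib)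
  have "mcoeff 0 0 \<noteq> mcoeff (1 :: 'a mfps) 0" by (simp add: mcoeff_1)
  then show "(0 :: 'a mfps) \<noteq> 1" by metis
qed (rule mfps_eqI; simp add: algebra_simps)+

end

text \<open>
  The usual topology on power series: coefficientwise convergence, with \<open>\<int>\<close> discrete,
  i.e. the product topology on coefficient functions.
\<close>

instantiation mfps :: (type) t2_space
begin

definition open_mfps_def: "open (U :: 'a mfps set) \<longleftrightarrow> open (mcoeff ` U)"

instance
proof
  have inj: "inj mcoeff" by (simp add: inj_def mcoeff_inject)
  have "mcoeff ` (UNIV :: 'a mfps set) = UNIV"
    by (metis mcoeff_Abs surj_def)
  then show "open (UNIV :: 'a mfps set)" by (simp add: open_mfps_def)
  show "open (S \<inter> T)" if "open S" "open T" for S T :: "'a mfps set"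
    using open_Int that unfolding open_mfps_def image_Int[OF inj] by blast
  show "open (\<Union>K)" if K: "\<forall>S\<in>K. open S" for K :: "'a mfps set set"
  proof -
    have "open (\<Union>S\<in>K. mcoeff ` S)"
    proof (rule open_UN, rule ballI)
      fix S assume "S \<in> K"
      with K show "open (mcoeff ` S)" unfolding open_mfps_def by blast
    qed
    then show ?thesis unfolding open_mfps_def image_Union .
  qed
  show "\<exists>U V. open U \<and> open V \<and> x \<in> U \<and> y \<in> V \<and> U \<inter> V = {}" if "x \<noteq> y" for x y :: "'a mfps"
  proof -
    from that obtain m where m: "mcoeff x m \<noteq> mcoeff y m"
      by (auto simp: mcoeff_inject[symmetric] fun_eq_iff)
    have "open {z. mcoeff z m = c}" for c
    proof -
      have "open ((\<lambda>f :: ('a \<Rightarrow>\<^sub>0 nat) \<Rightarrow> int. f m) -` {c})"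
        by (rule open_vimage[OF open_discrete continuous_on_product_coordinates])
      moreover have "mcoeff ` {z. mcoeff z m = c} = (\<lambda>f. f m) -` {c}"
      proof (intro set_eqI iffI)
        fix f assume "f \<in> (\<lambda>f. f m) -` {c}"
        then show "f \<in> mcoeff ` {z. mcoeff z m = c}"
          by (intro image_eqI[where x = "Abs_mfps f"]) simp_all
      qed (use image_iff in auto)
      ultimately show ?thesis by (simp add: open_mfps_def)
    qed
    then show ?thesis
      using m by (intro exI[of _ "{z. mcoeff z m = mcoeff x m}"] exI[of _ "{z. mcoeff z m = mcoeff y m}"]) auto
  qed
qed

end

lemma has_sum_mfpsI:
  fixes f :: "'i \<Rightarrow> 'v mfps"
  assumes fin: "\<And>m. finite {i \<in> S. mcoeff (f i) m \<noteq> 0}"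
  shows "(f has_sum Abs_mfps (\<lambda>m. \<Sum>i | i \<in> S \<and> mcoeff (f i) m \<noteq> 0. mcoeff (f i) m)) S"
    (is "(f has_sum ?s) S")
proof -
  have sum: "mcoeff (sum f F) m = (\<Sum>i\<in>F. mcoeff (f i) m)" for F m
    by (induction F rule: infinite_finite_induct) auto
  have "((\<lambda>i. mcoeff (f i) m) has_sum mcoeff ?s m) S" for m
    by (rule has_sum_finite_neutralI[OF fin]) auto
  then have "((\<lambda>F. mcoeff (sum f F) m) \<longlongrightarrow> mcoeff ?s m) (finite_subsets_at_top S)" for m
    by (simp add: has_sum_def sum)
  then have "limitin (product_topology (\<lambda>i. euclidean) UNIV)
      (\<lambda>F. mcoeff (sum f F)) (mcoeff ?s) (finite_subsets_at_top S)"
    by (simp add: limitin_componentwise)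
  then have lim: "((\<lambda>F. mcoeff (sum f F)) \<longlongrightarrow> mcoeff ?s) (finite_subsets_at_top S)"
    by (simp add: euclidean_product_topology)
  show ?thesis
    unfolding has_sum_def
  proof (rule topological_tendstoI)
    fix U assume U: "open U" "?s \<in> U"
    then have "eventually (\<lambda>F. mcoeff (sum f F) \<in> mcoeff ` U) (finite_subsets_at_top S)"
      by (intro topological_tendstoD[OF lim]) (auto simp: open_mfps_def simp del: mcoeff_Abs)
    then show "eventually (\<lambda>F. sum f F \<in> U) (finite_subsets_at_top S)"
      by eventually_elim (auto simp: mcoeff_inject)
  qed
qed

lemma summable_mfpsI:
  fixes f :: "'i \<Rightarrow> 'v mfps"
  assumes "\<And>m. finite {i \<in> S. mcoeff (f i) m \<noteq> 0}"
  shows "f summable_on S"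
  using has_sum_mfpsI[of S f] assms summable_on_def by blast

definition mvar :: "'v \<Rightarrow> 'v mfps"
  where "mvar v = Abs_mfps (\<lambda>m. if m = Poly_Mapping.single v 1 then 1 else 0)"

text \<open>
  Substitution of the power series \<open>y v\<close> for every variable \<open>v\<close>. As always for formal power
  series, it is meaningful only if the sum converges; lemma \<open>msubst_summable\<close> below covers
  its use here.
\<close>

definition msubst :: "('v \<Rightarrow> 'w mfps) \<Rightarrow> 'v mfps \<Rightarrow> 'w mfps"
  where "msubst y F = (\<Sum>\<^sub>\<infinity>m. of_int (mcoeff F m) * (\<Prod>v\<in>Poly_Mapping.keys m. y v ^ Poly_Mapping.lookup m v))"


section \<open>Posets and P-partitions\<close>

text \<open>
  A poset is a carrier \<open>P\<close> with a relation \<open>r\<close> such that \<open>partial_order_on P r\<close>;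
  \<open>(x, y) \<in> r\<close> means \<open>x \<le> y\<close>. P-partitions are extensional functions on \<open>P\<close>, so that
  each map on \<open>P\<close> contributes exactly one summand to the generating function.
\<close>

definition antichain_in :: "'a set \<Rightarrow> 'a rel \<Rightarrow> 'a set \<Rightarrow> bool"
  where "antichain_in P r A \<longleftrightarrow>
    A \<subseteq> P \<and> (\<forall>x\<in>A. \<forall>y\<in>A. x \<noteq> y \<longrightarrow> (x, y) \<notin> r \<and> (y, x) \<notin> r)"

definition P_partitions :: "'a set \<Rightarrow> 'a rel \<Rightarrow> ('a \<Rightarrow> nat) set"
  where "P_partitions P r =
    {\<sigma> \<in> P \<rightarrow>\<^sub>E UNIV. \<forall>x\<in>P. \<forall>y\<in>P. (x, y) \<in> r \<longrightarrow> \<sigma> x \<ge> \<sigma> y}"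

definition P_genfun :: "'a set \<Rightarrow> 'a rel \<Rightarrow> 'a mfps"
  where "P_genfun P r = (\<Sum>\<^sub>\<infinity>\<sigma>\<in>P_partitions P r. \<Prod>a\<in>P. mvar a ^ \<sigma> a)"


section \<open>Partially linear extensions\<close>

text \<open>
  In \<open>P(M,A)\<close> an element \<open>u\<close> of \<open>P - M\<close> is \<open>Inl u\<close>, and the glued element is \<open>Inr M\<close>.
\<close>

definition ple_carrier :: "'a set \<Rightarrow> 'a set \<Rightarrow> ('a + 'a set) set"
  where "ple_carrier P M = Inl ` (P - M) \<union> {Inr M}"

definition ple_rel :: "'a set \<Rightarrow> 'a rel \<Rightarrow> 'a set \<Rightarrow> 'a set \<Rightarrow> ('a + 'a set) rel"
  where "ple_rel P r M A =
      {(Inl x, Inl y) | x y. x \<in> P - M \<and> y \<in> P - M \<and> (x, y) \<in> r}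
    \<union> {(Inl x, Inl y) | x y. x \<in> P - M \<and> y \<in> P - M \<and>
         (\<exists>x'\<in>A. \<exists>y'\<in>M. (x, x') \<in> r \<and> (y', y) \<in> r)}
    \<union> {(Inr M, Inl y) | y. y \<in> P - M \<and> (\<exists>y'\<in>M. (y', y) \<in> r)}
    \<union> {(Inl x, Inr M) | x. x \<in> P - M \<and> (\<exists>x'\<in>A. (x, x') \<in> r)}
    \<union> {(Inr M, Inr M)}"

lemma partial_order_on_ple:
  assumes "partial_order_on P r" "antichain_in P r A" "M \<subseteq> A"
  shows "partial_order_on (ple_carrier P M) (ple_rel P r M A)"
proof -
  have r: "r \<subseteq> P \<times> P" "refl_on P r" "trans r" "antisym r"
    using assms(1) by (auto simp: partial_order_on_def preorder_on_def)
  have A: "A \<subseteq> P" "\<And>x y. x \<in> A \<Longrightarrow> y \<in> A \<Longrightarrow> (x, y) \<in> r \<Longrightarrow> x = y"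
    using assms(2) by (auto simp: antichain_in_def)
  define D where "D x \<longleftrightarrow> (\<exists>x'\<in>A. (x, x') \<in> r)" for x
  define U where "U y \<longleftrightarrow> (\<exists>y'\<in>M. (y', y) \<in> r)" for y
  have tr: "(x, z) \<in> r" if "(x, y) \<in> r" "(y, z) \<in> r" for x y z
    using r(3) that by (rule transD)
  have anti: "x = y" if "(x, y) \<in> r" "(y, x) \<in> r" for x y
    using r(4) that by (rule antisymD)
  have D: "D x" if "(x, y) \<in> r" "D y" for x y
    using that tr unfolding D_def by blast
  have U: "U y" if "(x, y) \<in> r" "U x" for x y
    using that tr unfolding U_def by blast
  have key: "x \<in> M" if "U x" "D x" for x
  proof -
    from that obtain x' y' where h: "y' \<in> M" "(y', x) \<in> r" "x' \<in> A" "(x, x') \<in> r"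
      unfolding D_def U_def by blast
    then have "y' = x'" using A(2)[of y' x'] tr assms(3) by blast
    with h have "x = y'" using anti by blast
    with h show ?thesis by simp
  qed
  have mem:
    "(Inl x, Inl y) \<in> ple_rel P r M A \<longleftrightarrow> x \<in> P - M \<and> y \<in> P - M \<and> ((x, y) \<in> r \<or> D x \<and> U y)"
    "(Inr N, Inl y) \<in> ple_rel P r M A \<longleftrightarrow> N = M \<and> y \<in> P - M \<and> U y"
    "(Inl x, Inr N) \<in> ple_rel P r M A \<longleftrightarrow> N = M \<and> x \<in> P - M \<and> D x"
    "(Inr N, Inr N') \<in> ple_rel P r M A \<longleftrightarrow> N = M \<and> N' = M" for x y N N'
    by (auto simp: ple_rel_def D_def U_def)
  have "ple_rel P r M A \<subseteq> ple_carrier P M \<times> ple_carrier P M"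
    by (auto simp: ple_rel_def ple_carrier_def)
  moreover have "refl_on (ple_carrier P M) (ple_rel P r M A)"
    using r(2) by (auto simp: refl_on_def ple_rel_def ple_carrier_def)
  moreover have "trans (ple_rel P r M A)"
  proof (rule transI)
    fix x y z assume "(x, y) \<in> ple_rel P r M A" "(y, z) \<in> ple_rel P r M A"
    then show "(x, z) \<in> ple_rel P r M A"
      by (cases x; cases y; cases z; simp add: mem; meson tr D U key)
  qed
  moreover have "antisym (ple_rel P r M A)"
  proof (rule antisymI)
    fix x y assume "(x, y) \<in> ple_rel P r M A" "(y, x) \<in> ple_rel P r M A"
    then show "x = y"
      by (cases x; cases y; simp add: mem; meson anti D U key)
  qed
  ultimately show ?thesis by (simp add: partial_order_on_def preorder_on_def)
qed


section \<open>Convergence\<close>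

definition monomial :: "('v \<Rightarrow>\<^sub>0 nat) \<Rightarrow> 'v mfps"
  where "monomial e = Abs_mfps (\<lambda>m. if m = e then 1 else 0)"

lemma mcoeff_monomial: "mcoeff (monomial e) m = (if m = e then 1 else 0)"
  by (simp add: monomial_def)

lemma mvar_monomial: "mvar v = monomial (Poly_Mapping.single v 1)"
  by (simp add: mvar_def monomial_def)

lemma monomial_0: "monomial 0 = 1"
  by (rule mfps_eqI) (simp add: mcoeff_monomial mcoeff_1)

lemma monomial_add: "monomial (d + e) = monomial d * monomial e"
proof (rule mfps_eqI)
  fix m
  have "mcoeff (monomial d * monomial e) m =
      (\<Sum>x\<in>{(p, q). p + q = m}. if x = (d, e) then 1 else 0)"
    unfolding mcoeff_mult by (intro sum.cong) (auto simp: mcoeff_monomial split: if_splits)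
  also have "\<dots> = mcoeff (monomial (d + e)) m"
    by (subst sum.delta) (auto simp: mcoeff_monomial)
  finally show "mcoeff (monomial (d + e)) m = mcoeff (monomial d * monomial e) m" by simp
qed

lemma monomial_sum: "monomial (\<Sum>i\<in>I. e i) = (\<Prod>i\<in>I. monomial (e i))"
  by (induction I rule: infinite_finite_induct) (auto simp: monomial_0 monomial_add)

lemma monomial_power: "monomial e ^ k = monomial (\<Sum>i<k. e)"
  by (induction k) (auto simp: monomial_0 monomial_add mult.commute)

lemma lookup_sum_single:
  assumes "finite S"
  shows "Poly_Mapping.lookup (\<Sum>a\<in>S. Poly_Mapping.single a (e a :: nat)) v = (if v \<in> S then e v else 0)"
  using assms by (simp add: lookup_sum lookup_single when_def sum.delta)

lemma mvar_power: "mvar a ^ k = monomial (Poly_Mapping.single a k)"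
proof (induction k)
  case (Suc k)
  have "Poly_Mapping.single a (Suc k) = Poly_Mapping.single a 1 + Poly_Mapping.single a k"
    by (simp flip: single_add)
  with Suc show ?case by (simp add: mvar_monomial monomial_add)
qed (simp add: monomial_0)

lemma prod_mvar:
  "(\<Prod>a\<in>S. mvar a ^ e a) = monomial (\<Sum>a\<in>S. Poly_Mapping.single a (e a))"
  by (simp add: mvar_power monomial_sum)

lemma P_partitions_monomial_finite:
  assumes "finite P"
  shows "finite {\<sigma> \<in> P_partitions P r. mcoeff (\<Prod>a\<in>P. mvar a ^ \<sigma> a) m \<noteq> 0}"
proof (rule finite_subset)
  show "{\<sigma> \<in> P_partitions P r. mcoeff (\<Prod>a\<in>P. mvar a ^ \<sigma> a) m \<noteq> 0}
      \<subseteq> {restrict (Poly_Mapping.lookup m) P}"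
    using assms
    by (auto simp: prod_mvar mcoeff_monomial P_partitions_def lookup_sum_single fun_eq_iff
        PiE_def extensional_def split: if_splits)
qed simp

lemma P_genfun_summable:
  assumes "finite P"
  shows "(\<lambda>\<sigma>. \<Prod>a\<in>P. mvar a ^ \<sigma> a) summable_on P_partitions P r"
  by (rule summable_mfpsI) (rule P_partitions_monomial_finite[OF assms])

lemma P_genfun_support:
  assumes "finite P" "mcoeff (P_genfun P r) m \<noteq> 0"
  shows "Poly_Mapping.keys m \<subseteq> P"
proof -
  have "mcoeff (P_genfun P r) m =
      (\<Sum>\<sigma> | \<sigma> \<in> P_partitions P r \<and> mcoeff (\<Prod>a\<in>P. mvar a ^ \<sigma> a) m \<noteq> 0.
         mcoeff (\<Prod>a\<in>P. mvar a ^ \<sigma> a) m)"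
    unfolding P_genfun_def
    by (subst infsumI[OF has_sum_mfpsI[OF P_partitions_monomial_finite[OF assms(1)]]]) simp
  with assms(2) obtain \<sigma> where "mcoeff (\<Prod>a\<in>P. mvar a ^ \<sigma> a) m \<noteq> 0"
    by (metis (mono_tags, lifting) mem_Collect_eq sum.neutral)
  then have "m = (\<Sum>a\<in>P. Poly_Mapping.single a (\<sigma> a))"
    by (simp add: prod_mvar mcoeff_monomial split: if_splits)
  then show ?thesis
    using assms(1) by (auto simp: in_keys_iff lookup_sum_single split: if_splits)
qed

lemma mcoeff_of_int_mult: "mcoeff (of_int c * f) m = c * mcoeff f m"
proof -
  have "mcoeff (of_nat n * f) m = of_nat n * mcoeff f m" for n
    by (induction n) (auto simp: algebra_simps)
  then show ?thesis by (cases c rule: int_cases2) auto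
qed

lemma msubst_summable:
  fixes P M :: "'a set" and R :: "('a + 'a set) rel"
  assumes "finite P" "M \<subseteq> P" "M \<noteq> {}"
  defines "y \<equiv> \<lambda>v. case v of Inl u \<Rightarrow> mvar u | Inr N \<Rightarrow> \<Prod>a\<in>N. mvar a"
  shows "(\<lambda>m. of_int (mcoeff (P_genfun (ple_carrier P M) R) m) *
    (\<Prod>v\<in>Poly_Mapping.keys m. y v ^ Poly_Mapping.lookup m v)) summable_on UNIV"
proof -
  let ?C = "ple_carrier P M"
  define e where "e v = (case v of Inl u \<Rightarrow> Poly_Mapping.single u (1::nat)
                | Inr N \<Rightarrow> \<Sum>a\<in>N. Poly_Mapping.single a 1)" for v :: "'a + 'a set"
  let ?img = "\<lambda>m :: ('a + 'a set) \<Rightarrow>\<^sub>0 nat. \<Sum>v\<in>Poly_Mapping.keys m. \<Sum>i<Poly_Mapping.lookup m v. e v"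
  have finC: "finite ?C" and finM: "finite M"
    using assms by (auto simp: ple_carrier_def finite_subset)
  have y: "y v = monomial (e v)" for v
    by (cases v) (simp_all add: y_def e_def mvar_monomial monomial_sum)
  have mon: "(\<Prod>v\<in>Poly_Mapping.keys m. y v ^ Poly_Mapping.lookup m v) = monomial (?img m)" for m
    unfolding y monomial_sum monomial_power ..
  have img: "Poly_Mapping.lookup (?img m) u =
      (\<Sum>v\<in>?C. Poly_Mapping.lookup m v * Poly_Mapping.lookup (e v) u)"
    if "Poly_Mapping.keys m \<subseteq> ?C" for m u
  proof -
    have "Poly_Mapping.lookup (?img m) u =
      (\<Sum>v\<in>Poly_Mapping.keys m. Poly_Mapping.lookup m v * Poly_Mapping.lookup (e v) u)"
      unfolding lookup_sum sum_constant card_lessThan of_nat_id ..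
    also have "\<dots> = (\<Sum>v\<in>?C. Poly_Mapping.lookup m v * Poly_Mapping.lookup (e v) u)"
      using that finC by (intro sum.mono_neutral_left) (auto simp: in_keys_iff)
    finally show ?thesis .
  qed
  obtain a0 where a0: "a0 \<in> M" using assms by blast
  have split: "(\<Sum>v\<in>?C. g v) = g (Inr M) + (\<Sum>w\<in>P - M. g (Inl w))" for g :: "_ \<Rightarrow> nat"
  proof -
    have "(\<Sum>v\<in>?C. g v) = (\<Sum>v\<in>insert (Inr M) (Inl ` (P - M)). g v)"
      by (simp add: ple_carrier_def)
    also have "\<dots> = g (Inr M) + (\<Sum>v\<in>Inl ` (P - M). g v)"
      using assms(1) by (intro sum.insert) auto
    finally show ?thesis by (simp add: sum.reindex)
  qed
  have e_Inl: "Poly_Mapping.lookup (e (Inl w)) u = (if w = u then 1 else 0)" for w u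
    by (simp add: e_def lookup_single when_def)
  have e_Inr: "Poly_Mapping.lookup (e (Inr M)) u = (if u \<in> M then 1 else 0)" for u
    using lookup_sum_single[OF finM, of "\<lambda>_. 1" u] by (simp add: e_def)
  have sumInl: "(\<Sum>w\<in>P - M. Poly_Mapping.lookup m (Inl w) * Poly_Mapping.lookup (e (Inl w)) u)
      = (if u \<in> P - M then Poly_Mapping.lookup m (Inl u) else 0)" for m u
  proof -
    have "(\<Sum>w\<in>P - M. Poly_Mapping.lookup m (Inl w) * Poly_Mapping.lookup (e (Inl w)) u)
      = (\<Sum>w\<in>P - M. if w = u then Poly_Mapping.lookup m (Inl w) else 0)"
      by (intro sum.cong) (auto simp: e_Inl)
    then show ?thesis using assms(1) by simp
  qed
  have Inl: "Poly_Mapping.lookup (?img m) u = Poly_Mapping.lookup m (Inl u)"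
    if "Poly_Mapping.keys m \<subseteq> ?C" "u \<in> P - M" for m u
    using that(2) unfolding img[OF that(1)] split sumInl e_Inr by simp
  have Inr: "Poly_Mapping.lookup (?img m) a0 = Poly_Mapping.lookup m (Inr M)"
    if "Poly_Mapping.keys m \<subseteq> ?C" for m
    using a0 unfolding img[OF that] split sumInl e_Inr by simp
  have inj: "inj_on ?img {m. Poly_Mapping.keys m \<subseteq> ?C}"
  proof (rule inj_onI)
    fix m n :: "('a + 'a set) \<Rightarrow>\<^sub>0 nat"
    assume mn: "m \<in> {m. Poly_Mapping.keys m \<subseteq> ?C}" "n \<in> {m. Poly_Mapping.keys m \<subseteq> ?C}"
      and eq: "?img m = ?img n"
    have mC: "Poly_Mapping.keys m \<subseteq> ?C" and nC: "Poly_Mapping.keys n \<subseteq> ?C"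
      using mn by blast+
    have "Poly_Mapping.lookup m v = Poly_Mapping.lookup n v" for v
    proof (cases "v \<in> ?C")
      case True
      then consider u where "u \<in> P - M" "v = Inl u" | "v = Inr M"
        by (auto simp: ple_carrier_def)
      then show ?thesis
      proof cases
        case 1
        show ?thesis
          unfolding 1(2) Inl[OF mC 1(1), symmetric] Inl[OF nC 1(1), symmetric] by (simp only: eq)
      next
        case 2
        show ?thesis
          unfolding 2 Inr[OF mC, symmetric] Inr[OF nC, symmetric] by (simp only: eq)
      qed
    next
      case False
      then have "v \<notin> Poly_Mapping.keys m" "v \<notin> Poly_Mapping.keys n" using mC nC by blast+
      then show ?thesis by (simp add: in_keys_iff)
    qed
    then show "m = n" by (rule poly_mapping_eqI)
  qed
  have "finite {m \<in> UNIV. mcoeff (of_int (mcoeff (P_genfun ?C R) m) * monomial (?img m)) k \<noteq> 0}" for k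
  proof (rule finite_subset)
    show "{m \<in> UNIV. mcoeff (of_int (mcoeff (P_genfun ?C R) m) * monomial (?img m)) k \<noteq> 0}
       \<subseteq> ?img -` {k} \<inter> {m. Poly_Mapping.keys m \<subseteq> ?C}"
    proof
      fix m
      assume "m \<in> {m \<in> UNIV. mcoeff (of_int (mcoeff (P_genfun ?C R) m) * monomial (?img m)) k \<noteq> 0}"
      then have "mcoeff (P_genfun ?C R) m * mcoeff (monomial (?img m)) k \<noteq> 0"
        unfolding mcoeff_of_int_mult by blast
      then have nz: "mcoeff (P_genfun ?C R) m \<noteq> 0" "mcoeff (monomial (?img m)) k \<noteq> 0"
        unfolding mult_eq_0_iff de_Morgan_disj by (rule conjunct1, elim conjunct2)
      have "k = ?img m"
        using nz(2) unfolding mcoeff_monomial by (rule contrapos_np) (simp only: if_False)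
      then show "m \<in> ?img -` {k} \<inter> {m. Poly_Mapping.keys m \<subseteq> ?C}"
        using P_genfun_support[OF finC nz(1)] by simp
    qed
    show "finite (?img -` {k} \<inter> {m. Poly_Mapping.keys m \<subseteq> ?C})"
      by (rule finite_vimage_IntI[OF _ inj]) simp
  qed
  then show ?thesis
    unfolding mon by (rule summable_mfpsI)
qed

end

theory Submission
  imports Defs
begin

text \<open>
  Ungluing \<open>M\<close> identifies the \<open>P(M,A)\<close>-partitions with the \<open>P\<close>-partitions that attain their
  minimum over \<open>A\<close> at every element of \<open>M\<close>. Hence a \<open>P\<close>-partition \<open>\<tau>\<close> is counted on the
  right-hand side once for every nonempty set \<open>M\<close> of minimisers of \<open>\<tau>\<close> on \<open>A\<close>, with sign
  \<open>(- 1) ^ (card M - 1)\<close>; as there is at least one minimiser, these signs add up to 1.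
\<close>

lemma mcoeff_sum: "mcoeff (sum f F) m = (\<Sum>i\<in>F. mcoeff (f i) m)"
  by (induction F rule: infinite_finite_induct) auto

lemma mcoeff_minus_one_power_mult: "mcoeff ((- 1) ^ n * f) m = (- 1) ^ n * mcoeff f m"
  using mcoeff_of_int_mult[of "(- 1) ^ n" f m] by simp

text \<open>Extensional maps on \<open>P\<close> correspond bijectively to the exponent vectors
  supported in \<open>P\<close>. Everything below reads coefficients and reindexes sums along this
  bijection.\<close>

lemma eq_sum_single_iff:
  fixes \<sigma> :: "'a \<Rightarrow> nat"
  assumes "finite P" "\<sigma> \<in> P \<rightarrow>\<^sub>E UNIV"
  shows "m = (\<Sum>a\<in>P. Poly_Mapping.single a (\<sigma> a)) \<longleftrightarrow>
    Poly_Mapping.keys m \<subseteq> P \<and> \<sigma> = restrict (Poly_Mapping.lookup m) P"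
proof -
  have "m = (\<Sum>a\<in>P. Poly_Mapping.single a (\<sigma> a)) \<longleftrightarrow>
    (\<forall>v. Poly_Mapping.lookup m v = (if v \<in> P then \<sigma> v else 0))"
    by (simp only: poly_mapping_eq_iff fun_eq_iff lookup_sum_single[OF assms(1)])
  also have "\<dots> \<longleftrightarrow> Poly_Mapping.keys m \<subseteq> P \<and> \<sigma> = restrict (Poly_Mapping.lookup m) P"
  proof -
    \<comment> \<open>Outside \<open>P\<close> both sides take the default value
      \<open>undefined\<close>, so only the values on \<open>P\<close> have to be compared.\<close>
    have *: "\<sigma> = restrict (Poly_Mapping.lookup m) P \<longleftrightarrow> (\<forall>v\<in>P. Poly_Mapping.lookup m v = \<sigma> v)"
      using assms(2) by (auto simp: fun_eq_iff PiE_def extensional_def)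
    show ?thesis unfolding * subset_iff in_keys_iff by metis
  qed
  finally show ?thesis .
qed

text \<open>Different maps have different monomials, so a coefficient receives at most one summand
  and is 0 or 1. This reduces identities between generating functions to membership of one explicit
  map in \<open>S\<close>.\<close>

lemma mcoeff_infsum_prod_mvar:
  assumes "finite P" "S \<subseteq> P \<rightarrow>\<^sub>E UNIV"
  shows "mcoeff (\<Sum>\<^sub>\<infinity>\<sigma>\<in>S. \<Prod>a\<in>P. mvar a ^ \<sigma> a) m =
    of_bool (Poly_Mapping.keys m \<subseteq> P \<and> restrict (Poly_Mapping.lookup m) P \<in> S)"
proof -
  have coeff: "mcoeff (\<Prod>a\<in>P. mvar a ^ \<sigma> a) n =
      of_bool (Poly_Mapping.keys n \<subseteq> P \<and> \<sigma> = restrict (Poly_Mapping.lookup n) P)"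
    if "\<sigma> \<in> S" for \<sigma> n
    using eq_sum_single_iff[OF assms(1), of \<sigma> n] assms(2) that
    by (auto simp: prod_mvar mcoeff_monomial)
  have supp: "{\<sigma> \<in> S. mcoeff (\<Prod>a\<in>P. mvar a ^ \<sigma> a) n \<noteq> 0} =
      (if Poly_Mapping.keys n \<subseteq> P \<and> restrict (Poly_Mapping.lookup n) P \<in> S
       then {restrict (Poly_Mapping.lookup n) P} else {})" for n
  proof -
    have "{\<sigma> \<in> S. mcoeff (\<Prod>a\<in>P. mvar a ^ \<sigma> a) n \<noteq> 0} =
        {\<sigma> \<in> S. Poly_Mapping.keys n \<subseteq> P \<and> \<sigma> = restrict (Poly_Mapping.lookup n) P}"
      by (intro Collect_cong conj_cong refl) (simp only: coeff of_bool_eq_0_iff not_not)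
    then show ?thesis by auto
  qed
  have "mcoeff (\<Sum>\<^sub>\<infinity>\<sigma>\<in>S. \<Prod>a\<in>P. mvar a ^ \<sigma> a) m =
      (\<Sum>\<sigma> | \<sigma> \<in> S \<and> mcoeff (\<Prod>a\<in>P. mvar a ^ \<sigma> a) m \<noteq> 0. mcoeff (\<Prod>a\<in>P. mvar a ^ \<sigma> a) m)"
    by (subst infsumI[OF has_sum_mfpsI]) (simp_all add: supp)
  then show ?thesis
    unfolding supp by (auto simp: coeff simp del: restrict_apply)
qed

text \<open>\<open>msubst\<close> sums over exponent vectors; since all coefficients are 0 or 1,
  this is a sum over the exponent vectors of the maps in \<open>S\<close>, which is then reindexed
  by the maps themselves.\<close>

lemma msubst_infsum_prod_mvar:
  assumes "finite P" "S \<subseteq> P \<rightarrow>\<^sub>E UNIV"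
  shows "msubst y (\<Sum>\<^sub>\<infinity>\<sigma>\<in>S. \<Prod>a\<in>P. mvar a ^ \<sigma> a) = (\<Sum>\<^sub>\<infinity>\<sigma>\<in>S. \<Prod>a\<in>P. y a ^ \<sigma> a)"
proof -
  let ?E = "{m. Poly_Mapping.keys m \<subseteq> P \<and> restrict (Poly_Mapping.lookup m) P \<in> S}"
  have "msubst y (\<Sum>\<^sub>\<infinity>\<sigma>\<in>S. \<Prod>a\<in>P. mvar a ^ \<sigma> a) =
      (\<Sum>\<^sub>\<infinity>m\<in>?E. \<Prod>v\<in>Poly_Mapping.keys m. y v ^ Poly_Mapping.lookup m v)"
    unfolding msubst_def mcoeff_infsum_prod_mvar[OF assms]
    by (rule infsum_cong_neutral) auto
  \<comment> \<open>Enlarging the index set from \<open>keys m\<close> to \<open>P\<close> only adds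
    factors with exponent 0.\<close>
  also have "\<dots> = (\<Sum>\<^sub>\<infinity>m\<in>?E. \<Prod>v\<in>P. y v ^ Poly_Mapping.lookup m v)"
    by (intro infsum_cong prod.mono_neutral_left) (auto simp: assms(1) in_keys_iff)
  also have "\<dots> = (\<Sum>\<^sub>\<infinity>\<sigma>\<in>S. \<Prod>a\<in>P. y a ^ \<sigma> a)"
  proof (rule infsum_reindex_bij_witness[where
        i = "\<lambda>\<sigma>. \<Sum>a\<in>P. Poly_Mapping.single a (\<sigma> a)" and
        j = "\<lambda>m. restrict (Poly_Mapping.lookup m) P"])
    fix \<sigma> assume \<sigma>: "\<sigma> \<in> S"
    let ?m = "\<Sum>a\<in>P. Poly_Mapping.single a (\<sigma> a)"
    have "\<sigma> \<in> P \<rightarrow>\<^sub>E UNIV" using \<sigma> assms(2) by (rule rev_subsetD)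
    note eq_sum_single_iff[OF assms(1) this, THEN iffD1, OF refl]
    note keys = this[THEN conjunct1] and eq = this[THEN conjunct2, symmetric]
    show "restrict (Poly_Mapping.lookup ?m) P = \<sigma>" by (rule eq)
    have "restrict (Poly_Mapping.lookup ?m) P \<in> S" unfolding eq by (rule \<sigma>)
    with keys show "?m \<in> ?E" by (intro CollectI conjI)
  next
    fix m assume m: "m \<in> ?E"
    have "restrict (Poly_Mapping.lookup m) P \<in> P \<rightarrow>\<^sub>E UNIV" by simp
    then show "(\<Sum>a\<in>P. Poly_Mapping.single a (restrict (Poly_Mapping.lookup m) P a)) = m"
      by (rule eq_sum_single_iff[OF assms(1), THEN iffD2, symmetric]) (use m in simp)
  qed auto
  finally show ?thesis .
qed

text \<open>For nonempty \<open>M\<close> \<subseteq> \<open>A\<close> these are the ungluings of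
  the \<open>P(M,A)\<close>-partitions; such a map is constant on \<open>M\<close>.\<close>

definition min_on_P_partitions :: "'a set \<Rightarrow> 'a rel \<Rightarrow> 'a set \<Rightarrow> 'a set \<Rightarrow> ('a \<Rightarrow> nat) set"
  where "min_on_P_partitions P r M A =
    {\<tau> \<in> P_partitions P r. \<forall>a\<in>M. \<forall>b\<in>A. \<tau> a \<le> \<tau> b}"

lemma prod_ple_carrier:
  assumes "finite P"
  shows "(\<Prod>v\<in>ple_carrier P M. g v) = g (Inr M) * (\<Prod>u\<in>P - M. g (Inl u))"
proof -
  have "(\<Prod>v\<in>ple_carrier P M. g v) = (\<Prod>v\<in>insert (Inr M) (Inl ` (P - M)). g v)"
    by (simp add: ple_carrier_def)
  also have "\<dots> = g (Inr M) * (\<Prod>v\<in>Inl ` (P - M). g v)"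
    using assms by (intro prod.insert) auto
  finally show ?thesis by (simp add: prod.reindex)
qed

text \<open>Ungluing gives every element of \<open>M\<close> the value at the glued element. It is a
  bijection onto the indicated maps, and it preserves monomials because the power of the product
  substituted for the glued variable spreads over \<open>M\<close>.\<close>

lemma msubst_P_genfun_ple:
  assumes "finite P" "refl_on P r" "A \<subseteq> P" "M \<subseteq> A" "M \<noteq> {}"
  shows "msubst (\<lambda>v. case v of Inl u \<Rightarrow> mvar u | Inr N \<Rightarrow> \<Prod>a\<in>N. mvar a)
      (P_genfun (ple_carrier P M) (ple_rel P r M A)) =
    (\<Sum>\<^sub>\<infinity>\<tau>\<in>min_on_P_partitions P r M A. \<Prod>a\<in>P. mvar a ^ \<tau> a)" (is "msubst ?y _ = _")
proof -
  let ?C = "ple_carrier P M" and ?R = "ple_rel P r M A"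
  \<comment> \<open>The value at the glued element is read off at an arbitrary representative of
    \<open>M\<close>; by \<open>const\<close> below the choice does not matter for the maps
    considered.\<close>
  define glue where "glue \<tau> = (\<lambda>v\<in>?C. case v of Inl u \<Rightarrow> \<tau> u | Inr N \<Rightarrow> \<tau> (SOME a. a \<in> M))"
    for \<tau> :: "'a \<Rightarrow> nat"
  define unglue where "unglue \<sigma> = (\<lambda>u\<in>P. if u \<in> M then \<sigma> (Inr M) else \<sigma> (Inl u))"
    for \<sigma> :: "'a + 'a set \<Rightarrow> nat"
  have some: "(SOME a. a \<in> M) \<in> M" using assms(5) by (simp add: some_in_eq)
  have MP: "M \<subseteq> P" using assms(3,4) by blast
  have finC: "finite ?C" using assms(1) by (simp add: ple_carrier_def)
  have const: "\<tau> a = \<tau> (SOME a. a \<in> M)"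
    if "\<tau> \<in> min_on_P_partitions P r M A" "a \<in> M" for \<tau> a
    using that some assms(4) unfolding min_on_P_partitions_def by (blast intro: antisym)
  have "msubst ?y (P_genfun ?C ?R) = (\<Sum>\<^sub>\<infinity>\<sigma>\<in>P_partitions ?C ?R. \<Prod>v\<in>?C. ?y v ^ \<sigma> v)"
    unfolding P_genfun_def
    by (rule msubst_infsum_prod_mvar[OF finC]) (auto simp: P_partitions_def)
  also have "\<dots> = (\<Sum>\<^sub>\<infinity>\<tau>\<in>min_on_P_partitions P r M A. \<Prod>a\<in>P. mvar a ^ \<tau> a)"
  proof (rule infsum_reindex_bij_witness[where i = glue and j = unglue])
    fix \<sigma> assume \<sigma>: "\<sigma> \<in> P_partitions ?C ?R"
    have ext: "\<sigma> v = undefined" if "v \<notin> ?C" for v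
      using \<sigma> that by (auto simp: P_partitions_def PiE_def extensional_def)
    have le: "\<sigma> v \<le> \<sigma> u" if "(u, v) \<in> ?R" "u \<in> ?C" "v \<in> ?C" for u v
      using \<sigma> that by (auto simp: P_partitions_def)
    show "glue (unglue \<sigma>) = \<sigma>"
    proof
      fix v
      show "glue (unglue \<sigma>) v = \<sigma> v"
        using some MP ext[of v]
        by (auto simp: glue_def unglue_def ple_carrier_def split: sum.split)
    qed
    have mem: "Inr M \<in> ?C" "\<And>u. u \<in> P - M \<Longrightarrow> Inl u \<in> ?C"
      by (auto simp: ple_carrier_def)
    have le1: "\<sigma> (Inl y) \<le> \<sigma> (Inl x)" if "(x, y) \<in> r" "x \<in> P - M" "y \<in> P - M" for x y
      using that by (intro le mem) (auto simp: ple_rel_def)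
    have le2: "\<sigma> (Inl y) \<le> \<sigma> (Inr M)" if "(x, y) \<in> r" "x \<in> M" "y \<in> P - M" for x y
      using that by (intro le mem) (auto simp: ple_rel_def)
    have le3: "\<sigma> (Inr M) \<le> \<sigma> (Inl x)" if "(x, y) \<in> r" "x \<in> P - M" "y \<in> A" for x y
      using that by (intro le mem) (auto simp: ple_rel_def)
    \<comment> \<open>By reflexivity every element of \<open>A - M\<close> lies below the glued
      element, so the glued value is minimal over \<open>A\<close>.\<close>
    have le4: "\<sigma> (Inr M) \<le> \<sigma> (Inl x)" if "x \<in> A - M" for x
      using that assms(2,3) by (intro le3[of x x]) (auto simp: refl_on_def)
    show "unglue \<sigma> \<in> min_on_P_partitions P r M A"
      using MP assms(3,4) le1 le2 le3 le4
      by (auto simp: min_on_P_partitions_def P_partitions_def unglue_def)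
    have "(\<Prod>v\<in>?C. ?y v ^ \<sigma> v) = (\<Prod>a\<in>M. mvar a ^ unglue \<sigma> a) * (\<Prod>a\<in>P - M. mvar a ^ unglue \<sigma> a)"
      using MP by (auto simp: prod_ple_carrier[OF assms(1)] prod_power_distrib unglue_def
          intro!: arg_cong2[of _ _ _ _ "(*)"] prod.cong)
    also have "\<dots> = (\<Prod>a\<in>P. mvar a ^ unglue \<sigma> a)"
      using prod.subset_diff[OF MP assms(1)] by (metis mult.commute)
    finally show "(\<Prod>a\<in>P. mvar a ^ unglue \<sigma> a) = (\<Prod>v\<in>?C. ?y v ^ \<sigma> v)" ..
  next
    fix \<tau> assume \<tau>: "\<tau> \<in> min_on_P_partitions P r M A"
    then have ext: "\<tau> v = undefined" if "v \<notin> P" for v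
      using that by (auto simp: min_on_P_partitions_def P_partitions_def PiE_def extensional_def)
    show "unglue (glue \<tau>) = \<tau>"
    proof
      fix u
      show "unglue (glue \<tau>) u = \<tau> u"
        using const[OF \<tau>, of u] ext[of u]
        by (auto simp: glue_def unglue_def ple_carrier_def)
    qed
    have mono: "\<tau> y \<le> \<tau> x" if "(x, y) \<in> r" "x \<in> P" "y \<in> P" for x y
      using \<tau> that by (auto simp: min_on_P_partitions_def P_partitions_def)
    have minM: "\<tau> a \<le> \<tau> b" if "a \<in> M" "b \<in> A" for a b
      using \<tau> that by (auto simp: min_on_P_partitions_def)
    have up: "\<tau> y \<le> \<tau> (SOME a. a \<in> M)" if "(y', y) \<in> r" "y' \<in> M" "y \<in> P" for y y'
      using mono[of y' y] const[OF \<tau> that(2)] that MP by auto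
    have down: "\<tau> (SOME a. a \<in> M) \<le> \<tau> x" if "(x, x') \<in> r" "x' \<in> A" "x \<in> P" for x x'
      using mono[of x x'] minM[OF some that(2)] that assms(3) by fastforce
    show "glue \<tau> \<in> P_partitions ?C ?R"
      unfolding P_partitions_def
    proof (intro CollectI conjI ballI impI)
      fix v w assume "v \<in> ?C" "w \<in> ?C" "(v, w) \<in> ?R"
      \<comment> \<open>Only the relations created by gluing two incomparable pieces need both
        bounds: there x \<le> x' in \<open>A\<close> and y' \<le> y with y' in \<open>M\<close>, and
        the value on \<open>M\<close> lies between those at y and x.\<close>
      then show "glue \<tau> w \<le> glue \<tau> v"
        by (auto simp: ple_rel_def glue_def intro: mono up down order.trans[OF up down])
    qed (simp add: glue_def)
  qed
  finally show ?thesis .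
qed

text \<open>Expanding (-1 + 1)^|B| = 0 over the subsets of \<open>B\<close> and moving the empty
  set's term 1 to the other side gives the claim.\<close>

lemma sum_alternating_nonempty_subsets:
  assumes "finite B" "B \<noteq> {}"
  shows "(\<Sum>M | M \<noteq> {} \<and> M \<subseteq> B. (- 1) ^ (card M - 1)) = (1 :: int)"
proof -
  have "(\<Prod>x\<in>B. (- 1) + 1) = (\<Sum>M\<in>Pow B. (\<Prod>x\<in>M. - 1) * (\<Prod>x\<in>B - M. 1 :: int))"
    using assms(1) by (rule prod_add)
  then have "0 = (\<Sum>M\<in>Pow B. (- 1 :: int) ^ card M)"
    using assms(2) by (simp add: zero_power card_gt_0_iff assms(1))
  also have "\<dots> = 1 + (\<Sum>M\<in>Pow B - {{}}. (- 1) ^ card M)"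
    using assms(1) by (subst sum.remove[of _ "{}"]) auto
  also have "(\<Sum>M\<in>Pow B - {{}}. (- 1 :: int) ^ card M) =
      - (\<Sum>M\<in>Pow B - {{}}. (- 1) ^ (card M - 1))"
    unfolding sum_negf[symmetric]
  proof (rule sum.cong)
    fix M assume "M \<in> Pow B - {{}}"
    \<comment> \<open>Positivity keeps the truncated subtraction \<open>card M - 1\<close> exact, so
      the two powers differ by one sign.\<close>
    then have "card M > 0" using assms(1) by (auto simp: card_gt_0_iff finite_subset)
    then show "(- 1 :: int) ^ card M = - ((- 1) ^ (card M - 1))" by (cases "card M") auto
  qed simp
  finally show ?thesis
    by (simp add: Pow_def set_diff_eq conj_commute)
qed

theorem theorem2p2:
  fixes P A :: "'a set" and r :: "'a rel"
  assumes "finite P"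
    and "partial_order_on P r"
    and "antichain_in P r A"
    and "A \<noteq> {}"
  shows "P_genfun P r =
    (\<Sum>M | M \<noteq> {} \<and> M \<subseteq> A. (- 1) ^ (card M - 1) *
       msubst (\<lambda>v. case v of Inl u \<Rightarrow> mvar u | Inr N \<Rightarrow> \<Prod>a\<in>N. mvar a)
         (P_genfun (ple_carrier P M) (ple_rel P r M A)))"
proof (rule mfps_eqI)
  fix k :: "'a \<Rightarrow>\<^sub>0 nat"
  \<comment> \<open>The only map on \<open>P\<close> that can contribute to the coefficient of
    \<open>k\<close>; \<open>B\<close> collects its minimisers on \<open>A\<close>.\<close>
  let ?\<tau> = "restrict (Poly_Mapping.lookup k) P"
  let ?valid = "Poly_Mapping.keys k \<subseteq> P \<and> ?\<tau> \<in> P_partitions P r"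
  define B where "B = {a \<in> A. \<forall>b\<in>A. ?\<tau> a \<le> ?\<tau> b}"
  have "refl_on P r" and AP: "A \<subseteq> P"
    using assms(2,3) by (auto simp: partial_order_on_def preorder_on_def antichain_in_def)
  have finA: "finite A" using AP assms(1) by (rule finite_subset)
  have "arg_min_on ?\<tau> A \<in> B"
    unfolding B_def using arg_min_if_finite(1)[OF finA assms(4), of ?\<tau>]
      arg_min_least[OF finA assms(4), where f = ?\<tau>] by blast
  then have B: "finite B" "B \<noteq> {}" using finite_subset[OF _ finA, of B] by (auto simp only: B_def)
  have "mcoeff ((- 1) ^ (card M - 1) *
      msubst (\<lambda>v. case v of Inl u \<Rightarrow> mvar u | Inr N \<Rightarrow> \<Prod>a\<in>N. mvar a)
         (P_genfun (ple_carrier P M) (ple_rel P r M A))) k =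
      (if M \<subseteq> B then (- 1) ^ (card M - 1) * of_bool ?valid else 0)"
    if "M \<noteq> {} \<and> M \<subseteq> A" for M
  proof -
    \<comment> \<open>As \<open>M\<close> \<subseteq> \<open>A\<close>, being minimal over
      \<open>A\<close> at each element of \<open>M\<close> means exactly \<open>M\<close>
      \<subseteq> \<open>B\<close>.\<close>
    have "restrict (Poly_Mapping.lookup k) P \<in> min_on_P_partitions P r M A \<longleftrightarrow>
        ?\<tau> \<in> P_partitions P r \<and> M \<subseteq> B"
      using that by (auto simp: min_on_P_partitions_def B_def)
    moreover have "min_on_P_partitions P r M A \<subseteq> P \<rightarrow>\<^sub>E UNIV"
      by (auto simp: min_on_P_partitions_def P_partitions_def)
    ultimately show ?thesis
      using that
      by (simp add: mcoeff_minus_one_power_mult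
          msubst_P_genfun_ple[OF assms(1) \<open>refl_on P r\<close> AP]
          mcoeff_infsum_prod_mvar[OF assms(1)])
  qed
  then have "mcoeff (\<Sum>M | M \<noteq> {} \<and> M \<subseteq> A. (- 1) ^ (card M - 1) *
       msubst (\<lambda>v. case v of Inl u \<Rightarrow> mvar u | Inr N \<Rightarrow> \<Prod>a\<in>N. mvar a)
         (P_genfun (ple_carrier P M) (ple_rel P r M A))) k =
      (\<Sum>M | M \<noteq> {} \<and> M \<subseteq> A. if M \<subseteq> B then (- 1) ^ (card M - 1) * of_bool ?valid else 0)"
    unfolding mcoeff_sum by (intro sum.cong) auto
  also have "\<dots> = (\<Sum>M | M \<noteq> {} \<and> M \<subseteq> B. (- 1) ^ (card M - 1) * of_bool ?valid)"
    using finA by (intro sum.mono_neutral_cong_right) (auto simp: B_def)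
  \<comment> \<open>The common factor is pulled out, and the remaining signs add up to 1 because
    \<open>B\<close> is nonempty.\<close>
  also have "\<dots> = of_bool ?valid"
    unfolding sum_distrib_right[symmetric] sum_alternating_nonempty_subsets[OF B] by simp
  also have "\<dots> = mcoeff (P_genfun P r) k"
    unfolding P_genfun_def
    by (subst mcoeff_infsum_prod_mvar[OF assms(1)]) (auto simp: P_partitions_def)
  finally show "mcoeff (P_genfun P r) k =
     mcoeff (\<Sum>M | M \<noteq> {} \<and> M \<subseteq> A. (- 1) ^ (card M - 1) *
       msubst (\<lambda>v. case v of Inl u \<Rightarrow> mvar u | Inr N \<Rightarrow> \<Prod>a\<in>N. mvar a)
         (P_genfun (ple_carrier P M) (ple_rel P r M A))) k" ..
qed

end
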